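(* Let $m,n,p,q$ be positive integers with $m+n=p+q$. Then $X_{m,n}\cong X_{p,q}$ as abstract algebraic varieties over $\mathbb{C}$.
   Context: For positive integers $m,n$, $X_{m,n}$ denotes the hypersurface in $\mathbb{A}^4=\mathrm{Spec}(\mathbb{C}[x,y,u,v])$ defined by the equation $x^m v-y^n u=1$. *)

theory Defs
  imports "HOL-Analysis.Analysis"
begin

text \<open>
  Varieties are taken in the classical sense: subsets of complex affine space with the induced
  Zariski topology and the sheaf of regular functions.  Affine \<open>n\<close>-space is \<^typ>\<open>complex^'n\<close>;
  since the ground field is infinite, polynomials are identified with polynomial functions.
\<close>

inductive polynomial_fun :: "(complex^'n \<Rightarrow> complex) \<Rightarrow> bool" where
  const: "polynomial_fun (\<lambda>_. c)"
| coord: "polynomial_fun (\<lambda>z. z $ i)"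
| add: "polynomial_fun f \<Longrightarrow> polynomial_fun g \<Longrightarrow> polynomial_fun (\<lambda>z. f z + g z)"
| mult: "polynomial_fun f \<Longrightarrow> polynomial_fun g \<Longrightarrow> polynomial_fun (\<lambda>z. f z * g z)"

definition zero_locus :: "(complex^'n \<Rightarrow> complex) set \<Rightarrow> (complex^'n) set" where
  "zero_locus F = {z. \<forall>f\<in>F. f z = 0}"

definition algebraic_set :: "(complex^'n) set \<Rightarrow> bool" where
  "algebraic_set Z \<longleftrightarrow> (\<exists>F. (\<forall>f\<in>F. polynomial_fun f) \<and> Z = zero_locus F)"

definition zariski :: "(complex^'n) topology" where
  "zariski = topology (\<lambda>U. algebraic_set (- U))"

lemma algebraic_set_Un:
  assumes "algebraic_set Y" "algebraic_set Z"
  shows "algebraic_set (Y \<union> Z)"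
proof -
  obtain F where F: "\<And>f. f \<in> F \<Longrightarrow> polynomial_fun f" and Y: "Y = zero_locus F"
    using assms(1) unfolding algebraic_set_def by blast
  obtain G where G: "\<And>g. g \<in> G \<Longrightarrow> polynomial_fun g" and Z: "Z = zero_locus G"
    using assms(2) unfolding algebraic_set_def by blast
  define H where "H = (\<lambda>(f, g) z. f z * g z) ` (F \<times> G)"
  have "polynomial_fun h" if h: "h \<in> H" for h
  proof -
    obtain f g where "f \<in> F" "g \<in> G" "h = (\<lambda>z. f z * g z)"
      using h unfolding H_def by auto
    then show ?thesis using F G by (simp add: polynomial_fun.mult)
  qed
  moreover have "z \<in> Y \<union> Z \<longleftrightarrow> z \<in> zero_locus H" for z
  proof -
    have "z \<in> zero_locus H \<longleftrightarrow> (\<forall>f\<in>F. \<forall>g\<in>G. f z = 0 \<or> g z = 0)"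
      by (simp add: zero_locus_def H_def)
    also have "\<dots> \<longleftrightarrow> (\<forall>f\<in>F. f z = 0) \<or> (\<forall>g\<in>G. g z = 0)"
      by blast
    finally show ?thesis by (simp add: Y Z zero_locus_def)
  qed
  ultimately show ?thesis unfolding algebraic_set_def by blast
qed

lemma algebraic_set_Inter:
  assumes "\<And>Z. Z \<in> K \<Longrightarrow> algebraic_set Z"
  shows "algebraic_set (\<Inter>K)"
proof -
  have "\<forall>Z\<in>K. \<exists>F. (\<forall>f\<in>F. polynomial_fun f) \<and> Z = zero_locus F"
    using assms unfolding algebraic_set_def by blast
  then obtain F where F: "\<And>Z. Z \<in> K \<Longrightarrow> (\<forall>f\<in>F Z. polynomial_fun f) \<and> Z = zero_locus (F Z)"
    by metis
  have mem: "z \<in> Z \<longleftrightarrow> (\<forall>f\<in>F Z. f z = 0)" if "Z \<in> K" for z Z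
    using F[OF that] unfolding zero_locus_def by blast
  have "\<Inter>K = zero_locus (\<Union>Z\<in>K. F Z)"
    using mem unfolding zero_locus_def by auto
  moreover have "\<forall>f\<in>(\<Union>Z\<in>K. F Z). polynomial_fun f" using F by blast
  ultimately show ?thesis unfolding algebraic_set_def by blast
qed

lemma openin_zariski:
  fixes U :: "(complex^'n) set"
  shows "openin zariski U \<longleftrightarrow> algebraic_set (- U)"
proof -
  have "istopology (\<lambda>U :: (complex^'n) set. algebraic_set (- U))"
    unfolding istopology_def
  proof (intro conjI allI impI)
    fix S T :: "(complex^'n) set"
    assume "algebraic_set (- S)" "algebraic_set (- T)"
    then show "algebraic_set (- (S \<inter> T))"
      using algebraic_set_Un by (metis Compl_Int)
  next
    fix K :: "(complex^'n) set set"
    assume "\<forall>S\<in>K. algebraic_set (- S)"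
    then have "algebraic_set (\<Inter>(uminus ` K))"
      by (intro algebraic_set_Inter) auto
    then show "algebraic_set (- \<Union>K)"
      by (simp add: uminus_Sup)
  qed
  then show ?thesis unfolding zariski_def by simp
qed

lemma topspace_zariski [simp]: "topspace zariski = (UNIV :: (complex^'n) set)"
proof -
  have "algebraic_set ({} :: (complex^'n) set)"
    unfolding algebraic_set_def zero_locus_def
    by (rule exI[of _ "{\<lambda>_. 1}"]) (auto intro: polynomial_fun.const)
  then have "openin zariski (UNIV :: (complex^'n) set)"
    by (simp add: openin_zariski)
  then show ?thesis using openin_subset top.extremum_uniqueI by metis
qed

text \<open>
  Regularity of a function on a locally closed set \<open>U\<close> (only its values on \<open>U\<close> matter):
  near every point it is a quotient of polynomials.
\<close>

definition regular_on :: "(complex^'n) set \<Rightarrow> (complex^'n \<Rightarrow> complex) \<Rightarrow> bool" where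
  "regular_on U f \<longleftrightarrow>
     (\<forall>z\<in>U. \<exists>V g h. openin (subtopology zariski U) V \<and> z \<in> V \<and>
        polynomial_fun g \<and> polynomial_fun h \<and> (\<forall>w\<in>V. h w \<noteq> 0 \<and> f w = g w / h w))"

definition variety_morphism ::
  "(complex^'n) set \<Rightarrow> (complex^'m) set \<Rightarrow> (complex^'n \<Rightarrow> complex^'m) \<Rightarrow> bool" where
  "variety_morphism X Y \<phi> \<longleftrightarrow>
     continuous_map (subtopology zariski X) (subtopology zariski Y) \<phi> \<and>
     (\<forall>V f. openin (subtopology zariski Y) V \<longrightarrow> regular_on V f \<longrightarrow>
        regular_on {z \<in> X. \<phi> z \<in> V} (f \<circ> \<phi>))"

definition isomorphic_varieties :: "(complex^'n) set \<Rightarrow> (complex^'m) set \<Rightarrow> bool" where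
  "isomorphic_varieties X Y \<longleftrightarrow>
     (\<exists>\<phi> \<psi>. variety_morphism X Y \<phi> \<and> variety_morphism Y X \<psi> \<and>
        (\<forall>z\<in>X. \<psi> (\<phi> z) = z) \<and> (\<forall>w\<in>Y. \<phi> (\<psi> w) = w))"

text \<open>
  The coordinates \<open>x, y, u, v\<close> are the components \<open>1, 2, 3, 4\<close>.  For \<open>m, n \<ge> 1\<close> the polynomial
  \<open>x\<^sup>m v - y\<^sup>n u - 1\<close> is irreducible, so the closed subscheme it defines is integral and
  is determined by its set of complex points.
\<close>

definition X_hyp :: "nat \<Rightarrow> nat \<Rightarrow> (complex^4) set" where
  "X_hyp m n = zero_locus {\<lambda>z. z$1 ^ m * z$4 - z$2 ^ n * z$3 - 1}"

end

theory Submission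
  imports Defs "HOL-Computational_Algebra.Polynomial"
begin

text \<open>
  Projection to \<open>(x, y)\<close> makes \<open>X\<^sub>m\<^sub>,\<^sub>n\<close> an affine-line bundle over the punctured plane, with
  gluing cocycle \<open>1 / (x\<^sup>m y\<^sup>n)\<close>.  Different exponents give different bundles, so an isomorphism
  cannot respect these projections.  The idea is to exhibit on \<open>X\<^sub>m\<^sub>,\<^sub>n\<close> a second projection to a
  punctured plane whose cocycle depends only on \<open>N = m + n - 1\<close>.  This is the mechanism behind the
  Danilov--Gizatullin theorem, where one looks at the pencil of sections touching a given ample
  section to maximal order at a general point of the base.  Here the general point is the zero
  of the linear form \<open>l = x + y\<close>.

  Every monomial of degree \<open>N\<close> is divisible by \<open>x\<^sup>m\<close> or by \<open>y\<^sup>n\<close>, but not by both, so there are unique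
  forms \<open>A\<close>, \<open>B\<close> with \<open>x\<^sup>m A + y\<^sup>n B = l\<^sup>N\<close> (\<open>trunc_form_bezout\<close>).  The second coordinate of the new
  projection is \<open>w = A u + B v\<close>.  Together with \<open>x\<^sup>m v - y\<^sup>n u = 1\<close> this is a linear system for \<open>u, v\<close>
  of determinant \<open>\<plusminus> l\<^sup>N\<close>, whose solution reads \<open>l\<^sup>N u = x\<^sup>m w - B\<close> and \<open>l\<^sup>N v = y\<^sup>n w + A\<close>.
  Writing \<open>B\<close> in terms of \<open>x\<close> and \<open>l\<close> and multiplying by \<open>w\<^sup>m\<^sup>-\<^sup>1\<close> turns \<open>x\<^sup>m w \<equiv> B\<close> modulo \<open>l\<^sup>N\<close>
  into a polynomial equation for \<open>h = x w\<close> with coefficients in \<open>s = l w\<close>.  At \<open>s = 0\<close> it has a nonzero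
  simple root, a binomial coefficient \<open>\<beta>\<close>.  By Hensel's lemma there is one polynomial
  \<open>H\<close> in one variable, with \<open>H(0) = \<beta>\<close>, such that \<open>x w \<equiv> H(l w)\<close> modulo \<open>l\<^sup>N\<close>
  (\<open>branch_eqn_truncated_root\<close> and \<open>branch_eqn_root_unique\<close>).

  Write \<open>H(s) = \<beta> + s K(s)\<close> and \<open>x w - H(l w) = l\<^sup>N g\<close>.  Then \<open>w (x - l K(l w)) = \<beta> + l\<^sup>N g\<close>, which is, up to
  the factor \<open>\<beta>\<close> and signs, the equation of \<open>X\<^sub>N\<^sub>,\<^sub>1\<close> in the coordinates \<open>l\<close>, \<open>w\<close>, \<open>x - l K(l w)\<close>, \<open>g\<close>.
  The inverse recovers \<open>x\<close> and \<open>y = l - x\<close> at once and \<open>u, v\<close> by division by \<open>l\<^sup>N\<close>; the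
  same congruence shows that the division is possible on \<open>X\<^sub>N\<^sub>,\<^sub>1\<close>.  Thus
  \<open>X\<^sub>m\<^sub>,\<^sub>n\<close> is isomorphic to \<open>X\<^sub>N\<^sub>,\<^sub>1\<close>, which sees only the sum \<open>m + n\<close>.
\<close>

section \<open>Polynomial maps as morphisms\<close>

lemmas polynomial_fun_basic = polynomial_fun.const polynomial_fun.coord polynomial_fun.add polynomial_fun.mult

lemma polynomial_fun_diff:
  assumes "polynomial_fun f" "polynomial_fun g"
  shows "polynomial_fun (\<lambda>z. f z - g z)"
  using polynomial_fun.add[OF assms(1) polynomial_fun.mult[OF polynomial_fun.const[of "-1"] assms(2)]]
  by simp

lemma polynomial_fun_minus: "polynomial_fun f \<Longrightarrow> polynomial_fun (\<lambda>z. - f z)"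
  using polynomial_fun_diff[OF polynomial_fun.const[of 0], of f] by simp

lemma polynomial_fun_divide_const: "polynomial_fun f \<Longrightarrow> polynomial_fun (\<lambda>z. f z / c)"
  using polynomial_fun.mult[OF _ polynomial_fun.const[of "inverse c"], of f] by (simp add: divide_inverse)

lemma polynomial_fun_power: "polynomial_fun f \<Longrightarrow> polynomial_fun (\<lambda>z. f z ^ k)"
  by (induction k) (simp_all add: polynomial_fun_basic)

lemma polynomial_fun_sum:
  "(\<And>i. i \<in> I \<Longrightarrow> polynomial_fun (f i)) \<Longrightarrow> polynomial_fun (\<lambda>z. \<Sum>i\<in>I. f i z)"
  by (induction I rule: infinite_finite_induct) (simp_all add: polynomial_fun_basic)

lemma polynomial_fun_poly: "polynomial_fun f \<Longrightarrow> polynomial_fun (\<lambda>z. poly P (f z))"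
  by (induction P) (simp_all add: polynomial_fun_basic)

lemmas polynomial_fun_intros = polynomial_fun_basic polynomial_fun_diff polynomial_fun_minus
  polynomial_fun_divide_const polynomial_fun_power polynomial_fun_sum polynomial_fun_poly

lemma polynomial_fun_compose:
  assumes "polynomial_fun f" and "\<And>i. polynomial_fun (\<lambda>z. \<phi> z $ i)"
  shows "polynomial_fun (\<lambda>z. f (\<phi> z))"
  using assms(1) by induction (simp_all add: polynomial_fun_basic assms(2))

lemma continuous_on_polynomial_fun: "polynomial_fun f \<Longrightarrow> continuous_on S f"
  by (induction rule: polynomial_fun.induct) (auto intro!: continuous_intros)

lemma algebraic_set_vimage:
  assumes "algebraic_set Z" and "\<And>i. polynomial_fun (\<lambda>z. \<phi> z $ i)"
  shows "algebraic_set (\<phi> -` Z)"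
proof -
  obtain F where F: "\<forall>f\<in>F. polynomial_fun f" "Z = zero_locus F"
    using assms(1) unfolding algebraic_set_def by blast
  have "\<phi> -` Z = zero_locus ((\<lambda>f z. f (\<phi> z)) ` F)"
    unfolding F(2) zero_locus_def by auto
  moreover have "\<forall>f\<in>(\<lambda>f z. f (\<phi> z)) ` F. polynomial_fun f"
    using F(1) assms(2) by (auto intro: polynomial_fun_compose)
  ultimately show ?thesis unfolding algebraic_set_def by blast
qed

text \<open>
  Pulling back along a polynomial map turns zero loci into zero loci and quotients of polynomials into
  quotients of polynomials, so continuity and regularity both come from substitution.
\<close>

lemma variety_morphism_polynomial_map:
  assumes poly: "\<And>i. polynomial_fun (\<lambda>z. \<phi> z $ i)" and maps: "\<And>z. z \<in> X \<Longrightarrow> \<phi> z \<in> Y"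
  shows "variety_morphism X Y \<phi>"
proof -
  have preimage: "openin (subtopology zariski A) {z \<in> A. \<phi> z \<in> W}"
    if W: "openin (subtopology zariski B) W" and AB: "\<And>z. z \<in> A \<Longrightarrow> \<phi> z \<in> B" for A B W
  proof -
    obtain T where T: "openin zariski T" "W = T \<inter> B"
      using W by (auto simp: openin_subtopology)
    have "openin zariski (\<phi> -` T)"
      using T(1) algebraic_set_vimage[OF _ poly] by (auto simp: openin_zariski simp flip: vimage_Compl)
    moreover have "{z \<in> A. \<phi> z \<in> W} = \<phi> -` T \<inter> A"
      using T(2) AB by auto
    ultimately show ?thesis by (auto simp: openin_subtopology)
  qed
  have "continuous_map (subtopology zariski X) (subtopology zariski Y) \<phi>"
    unfolding continuous_map_def using maps preimage[of Y _ X] by auto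
  moreover have "regular_on {z \<in> X. \<phi> z \<in> V} (f \<circ> \<phi>)" if reg: "regular_on V f" for V f
    unfolding regular_on_def
  proof
    fix z assume z: "z \<in> {z \<in> X. \<phi> z \<in> V}"
    then obtain W g h where W: "openin (subtopology zariski V) W" "\<phi> z \<in> W"
      "polynomial_fun g" "polynomial_fun h" "\<forall>w\<in>W. h w \<noteq> 0 \<and> f w = g w / h w"
      using reg unfolding regular_on_def by blast
    let ?W = "{z \<in> {z \<in> X. \<phi> z \<in> V}. \<phi> z \<in> W}"
    have "openin (subtopology zariski {z \<in> X. \<phi> z \<in> V}) ?W"
      using preimage[OF W(1), of "{z \<in> X. \<phi> z \<in> V}"] by simp
    moreover have "\<forall>w\<in>?W. h (\<phi> w) \<noteq> 0 \<and> (f \<circ> \<phi>) w = g (\<phi> w) / h (\<phi> w)"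
      using W(5) by simp
    ultimately show "\<exists>V' g h. openin (subtopology zariski {z \<in> X. \<phi> z \<in> V}) V' \<and> z \<in> V' \<and>
        polynomial_fun g \<and> polynomial_fun h \<and> (\<forall>w\<in>V'. h w \<noteq> 0 \<and> (f \<circ> \<phi>) w = g w / h w)"
      using z W(2) polynomial_fun_compose[OF W(3) poly] polynomial_fun_compose[OF W(4) poly]
      by (intro exI[of _ ?W] exI[of _ "\<lambda>z. g (\<phi> z)"] exI[of _ "\<lambda>z. h (\<phi> z)"]) simp
  qed
  ultimately show ?thesis unfolding variety_morphism_def by blast
qed

lemma variety_morphism_maps: "variety_morphism X Y \<phi> \<Longrightarrow> z \<in> X \<Longrightarrow> \<phi> z \<in> Y"
  unfolding variety_morphism_def continuous_map_def by auto

lemma variety_morphism_compose: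
  assumes "variety_morphism X Y \<phi>" "variety_morphism Y Z \<psi>"
  shows "variety_morphism X Z (\<psi> \<circ> \<phi>)"
proof -
  have "regular_on {z \<in> X. (\<psi> \<circ> \<phi>) z \<in> V} (f \<circ> (\<psi> \<circ> \<phi>))"
    if V: "openin (subtopology zariski Z) V" and f: "regular_on V f" for V f
  proof -
    let ?W = "{w \<in> Y. \<psi> w \<in> V}"
    have "openin (subtopology zariski Y) ?W"
      using assms(2) V openin_continuous_map_preimage unfolding variety_morphism_def by fastforce
    moreover have "regular_on ?W (f \<circ> \<psi>)"
      using assms(2) V f unfolding variety_morphism_def by blast
    ultimately have "regular_on {z \<in> X. \<phi> z \<in> ?W} ((f \<circ> \<psi>) \<circ> \<phi>)"
      using assms(1) unfolding variety_morphism_def by blast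
    moreover have "{z \<in> X. \<phi> z \<in> ?W} = {z \<in> X. (\<psi> \<circ> \<phi>) z \<in> V}"
      using variety_morphism_maps[OF assms(1)] by auto
    ultimately show ?thesis by (simp add: comp_assoc)
  qed
  moreover have "continuous_map (subtopology zariski X) (subtopology zariski Z) (\<psi> \<circ> \<phi>)"
    using assms unfolding variety_morphism_def by (auto intro: continuous_map_compose)
  ultimately show ?thesis
    unfolding variety_morphism_def by simp
qed

lemma isomorphic_varieties_sym: "isomorphic_varieties X Y \<Longrightarrow> isomorphic_varieties Y X"
  unfolding isomorphic_varieties_def by blast

lemma isomorphic_varieties_trans:
  assumes "isomorphic_varieties X Y" "isomorphic_varieties Y Z"
  shows "isomorphic_varieties X Z"
proof -
  obtain \<phi> \<psi> where 1: "variety_morphism X Y \<phi>" "variety_morphism Y X \<psi>"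
    "\<forall>z\<in>X. \<psi> (\<phi> z) = z" "\<forall>w\<in>Y. \<phi> (\<psi> w) = w"
    using assms(1) unfolding isomorphic_varieties_def by blast
  obtain \<phi>' \<psi>' where 2: "variety_morphism Y Z \<phi>'" "variety_morphism Z Y \<psi>'"
    "\<forall>z\<in>Y. \<psi>' (\<phi>' z) = z" "\<forall>w\<in>Z. \<phi>' (\<psi>' w) = w"
    using assms(2) unfolding isomorphic_varieties_def by blast
  have "variety_morphism X Z (\<phi>' \<circ> \<phi>)" "variety_morphism Z X (\<psi> \<circ> \<psi>')"
    using 1 2 variety_morphism_compose by blast+
  moreover have "\<forall>z\<in>X. (\<psi> \<circ> \<psi>') ((\<phi>' \<circ> \<phi>) z) = z" "\<forall>w\<in>Z. (\<phi>' \<circ> \<phi>) ((\<psi> \<circ> \<psi>') w) = w"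
    using 1 2 variety_morphism_maps[OF 1(1)] variety_morphism_maps[OF 2(2)] by auto
  ultimately show ?thesis unfolding isomorphic_varieties_def by blast
qed

section \<open>Congruences modulo powers of a polynomial\<close>

text \<open>
  Congruence modulo \<open>l\<^sup>k\<close> in the coordinate ring of \<open>X\<close>.  The quotient is required to be a polynomial
  and to satisfy the identity at all points of \<open>X\<close>, including those where \<open>l\<close> vanishes.  Building
  polynomiality of both sides into the relation leaves the compatibility rules without side conditions.
\<close>

definition cong_along ::
  "(complex^'n) set \<Rightarrow> (complex^'n \<Rightarrow> complex) \<Rightarrow> nat \<Rightarrow> (complex^'n \<Rightarrow> complex) \<Rightarrow> (complex^'n \<Rightarrow> complex) \<Rightarrow> bool"
  where "cong_along X l k f g \<longleftrightarrow> polynomial_fun f \<and> polynomial_fun g \<and>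
     (\<exists>q. polynomial_fun q \<and> (\<forall>z\<in>X. f z - g z = l z ^ k * q z))"

lemma cong_alongI:
  assumes "polynomial_fun f" "polynomial_fun g" "polynomial_fun q"
    "\<And>z. z \<in> X \<Longrightarrow> f z - g z = l z ^ k * q z"
  shows "cong_along X l k f g"
  using assms unfolding cong_along_def by blast

lemma cong_alongE:
  assumes "cong_along X l k f g"
  obtains q where "polynomial_fun f" "polynomial_fun g" "polynomial_fun q"
    "\<And>z. z \<in> X \<Longrightarrow> f z - g z = l z ^ k * q z"
  using assms unfolding cong_along_def by blast

lemma cong_along_refl: "polynomial_fun f \<Longrightarrow> cong_along X l k f f"
  by (rule cong_alongI[where q = "\<lambda>_. 0"]) (simp_all add: polynomial_fun_basic)

lemma cong_along_sym: "cong_along X l k f g \<Longrightarrow> cong_along X l k g f"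
  by (erule cong_alongE, rule cong_alongI[where q = "\<lambda>z. - q z" for q])
    (auto simp: polynomial_fun_minus algebra_simps)

lemma cong_along_trans:
  assumes "cong_along X l k f g" "cong_along X l k g h"
  shows "cong_along X l k f h"
proof -
  obtain q where q: "polynomial_fun f" "polynomial_fun q" "\<And>z. z \<in> X \<Longrightarrow> f z - g z = l z ^ k * q z"
    using assms(1) by (rule cong_alongE) blast
  obtain r where r: "polynomial_fun h" "polynomial_fun r" "\<And>z. z \<in> X \<Longrightarrow> g z - h z = l z ^ k * r z"
    using assms(2) by (rule cong_alongE) blast
  have "f z - h z = l z ^ k * (q z + r z)" if "z \<in> X" for z
    using q(3)[OF that] r(3)[OF that] by (simp add: algebra_simps)
  then show ?thesis
    using q r by (intro cong_alongI[where q = "\<lambda>z. q z + r z"]) (simp_all add: polynomial_fun_basic)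
qed

lemma cong_along_add:
  assumes "cong_along X l k f g" "cong_along X l k f' g'"
  shows "cong_along X l k (\<lambda>z. f z + f' z) (\<lambda>z. g z + g' z)"
proof -
  obtain q where q: "polynomial_fun f" "polynomial_fun g" "polynomial_fun q"
    "\<And>z. z \<in> X \<Longrightarrow> f z - g z = l z ^ k * q z"
    using assms(1) by (rule cong_alongE) blast
  obtain r where r: "polynomial_fun f'" "polynomial_fun g'" "polynomial_fun r"
    "\<And>z. z \<in> X \<Longrightarrow> f' z - g' z = l z ^ k * r z"
    using assms(2) by (rule cong_alongE) blast
  have "(f z + f' z) - (g z + g' z) = l z ^ k * (q z + r z)" if "z \<in> X" for z
    using q(4)[OF that] r(4)[OF that] by (simp add: algebra_simps)
  then show ?thesis
    using q r by (intro cong_alongI[where q = "\<lambda>z. q z + r z"]) (simp_all add: polynomial_fun_basic)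
qed

lemma cong_along_mult:
  assumes "cong_along X l k f g" "cong_along X l k f' g'"
  shows "cong_along X l k (\<lambda>z. f z * f' z) (\<lambda>z. g z * g' z)"
proof -
  obtain q where q: "polynomial_fun f" "polynomial_fun g" "polynomial_fun q"
    "\<And>z. z \<in> X \<Longrightarrow> f z - g z = l z ^ k * q z"
    using assms(1) by (rule cong_alongE) blast
  obtain r where r: "polynomial_fun f'" "polynomial_fun g'" "polynomial_fun r"
    "\<And>z. z \<in> X \<Longrightarrow> f' z - g' z = l z ^ k * r z"
    using assms(2) by (rule cong_alongE) blast
  have "f z * f' z - g z * g' z = l z ^ k * (q z * f' z + g z * r z)" if "z \<in> X" for z
  proof -
    have "f z * f' z - g z * g' z = (f z - g z) * f' z + g z * (f' z - g' z)"
      by (simp add: algebra_simps)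
    also have "\<dots> = l z ^ k * (q z * f' z + g z * r z)"
      unfolding q(4)[OF that] r(4)[OF that] by (simp add: algebra_simps)
    finally show ?thesis .
  qed
  then show ?thesis
    using q r by (intro cong_alongI[where q = "\<lambda>z. q z * f' z + g z * r z"]) (simp_all add: polynomial_fun_basic)
qed

lemma cong_along_diff:
  assumes "cong_along X l k f g" "cong_along X l k f' g'"
  shows "cong_along X l k (\<lambda>z. f z - f' z) (\<lambda>z. g z - g' z)"
  using cong_along_add[OF assms(1) cong_along_mult[OF cong_along_refl[OF polynomial_fun.const[of "-1"]] assms(2)]]
  by simp

lemma cong_along_power:
  "cong_along X l k f g \<Longrightarrow> cong_along X l k (\<lambda>z. f z ^ j) (\<lambda>z. g z ^ j)"
  by (induction j) (simp_all add: cong_along_refl cong_along_mult polynomial_fun_basic)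

lemma cong_along_sum:
  "(\<And>i. i \<in> I \<Longrightarrow> cong_along X l k (f i) (g i)) \<Longrightarrow>
    cong_along X l k (\<lambda>z. \<Sum>i\<in>I. f i z) (\<lambda>z. \<Sum>i\<in>I. g i z)"
  by (induction I rule: infinite_finite_induct)
    (simp_all add: cong_along_refl cong_along_add polynomial_fun_basic)

lemmas cong_along_intros = cong_along_add cong_along_mult cong_along_diff cong_along_power cong_along_sum

lemma cong_along_mono:
  assumes "cong_along X l k f g" "j \<le> k" "polynomial_fun l"
  shows "cong_along X l j f g"
proof -
  obtain q where q: "polynomial_fun f" "polynomial_fun g" "polynomial_fun q"
    "\<And>z. z \<in> X \<Longrightarrow> f z - g z = l z ^ k * q z"
    using assms(1) by (rule cong_alongE) blast
  have "f z - g z = l z ^ j * (l z ^ (k - j) * q z)" if "z \<in> X" for z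
    using q(4)[OF that] assms(2) by (simp flip: power_add mult.assoc)
  then show ?thesis
    using q assms(3) by (intro cong_alongI[where q = "\<lambda>z. l z ^ (k - j) * q z"])
      (simp_all add: polynomial_fun_intros)
qed

text \<open>
  An element that is invertible modulo \<open>l\<close> is invertible modulo every power of \<open>l\<close>.  Each induction step
  gains one factor \<open>l\<close> by writing the unit \<open>c\<close> as \<open>e r\<close> minus a multiple of \<open>l\<close>.
\<close>

lemma cong_along_cancel_unit:
  assumes unit: "cong_along X l 1 (\<lambda>z. e z * r z) (\<lambda>_. c)" "c \<noteq> 0"
    and e: "polynomial_fun r"
    and fg: "polynomial_fun f" "polynomial_fun g"
    and cong: "cong_along X l k (\<lambda>z. e z * f z) (\<lambda>z. e z * g z)"
    and l: "polynomial_fun l"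
  shows "cong_along X l k f g"
  using cong
proof (induction k)
  case 0
  show ?case
    by (rule cong_alongI[where q = "\<lambda>z. f z - g z"]) (simp_all add: fg polynomial_fun_intros)
next
  case (Suc k)
  from unit(1) obtain a where a: "polynomial_fun a" "\<And>z. z \<in> X \<Longrightarrow> e z * r z - c = l z * a z"
    by (auto elim: cong_alongE)
  from Suc.prems obtain b where b: "polynomial_fun b"
    "\<And>z. z \<in> X \<Longrightarrow> e z * f z - e z * g z = l z ^ Suc k * b z"
    by (auto elim: cong_alongE)
  have "cong_along X l k f g"
    using Suc.IH cong_along_mono[OF Suc.prems _ l] by simp
  then obtain h where h: "polynomial_fun h" "\<And>z. z \<in> X \<Longrightarrow> f z - g z = l z ^ k * h z"
    by (auto elim: cong_alongE)
  have "f z - g z = l z ^ Suc k * ((r z * b z - a z * h z) / c)" if z: "z \<in> X" for z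
  proof -
    have "c * (f z - g z) = r z * (e z * f z - e z * g z) - (e z * r z - c) * (f z - g z)"
      by (simp add: algebra_simps)
    also have "\<dots> = l z ^ Suc k * (r z * b z - a z * h z)"
      unfolding a(2)[OF z] b(2)[OF z] unfolding h(2)[OF z] by (simp add: algebra_simps)
    finally show ?thesis using unit(2) by (simp add: field_simps)
  qed
  then show ?case
    using fg e a(1) b(1) h(1)
    by (intro cong_alongI[where q = "\<lambda>z. (r z * b z - a z * h z) / c"]) (simp_all add: polynomial_fun_intros)
qed

section \<open>A Bezout identity for two coordinate powers\<close>

text \<open>
  The binomial series of \<open>(1 - x)\<close> to the power \<open>-r\<close>, truncated before \<open>x\<^sup>m\<close> and homogenised by \<open>l\<close>.
  With \<open>y = l - x\<close> this is the truncated inverse of \<open>y\<^sup>r\<close>, which is why it is the coefficient of \<open>y\<^sup>r\<close>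
  in the Bezout identity below.  Using \<open>x, l\<close> rather than \<open>x, y\<close> as variables makes all coefficients
  positive and the value at \<open>l = 0\<close> a single monomial.
\<close>

definition trunc_form :: "nat \<Rightarrow> nat \<Rightarrow> 'a::comm_ring_1 \<Rightarrow> 'a \<Rightarrow> 'a" where
  "trunc_form r m x l = (\<Sum>k<m. of_nat ((r + k - 1) choose k) * x ^ k * l ^ (m - 1 - k))"

lemma trunc_form_eq_partial_binomial:
  fixes x y :: complex
  assumes "m > 0" "r > 0"
  shows "y ^ r * trunc_form r m x (x + y) = (\<Sum>k<m. of_nat ((m + r - 1) choose k) * x ^ k * y ^ (m + r - 1 - k))"
proof -
  obtain m' r' where m': "m = Suc m'" and r': "r = Suc r'"
    using assms by (metis Suc_pred)
  have "trunc_form r m x (x + y) = (\<Sum>k\<le>m'. (of_nat k + of_nat r - 1 gchoose k) * x ^ k * (x + y) ^ (m' - k))"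
    unfolding trunc_form_def m' lessThan_Suc_atMost
    by (intro sum.cong) (simp_all add: r' binomial_gbinomial algebra_simps)
  also have "\<dots> = (\<Sum>k\<le>m'. (of_nat m' + of_nat r gchoose k) * x ^ k * y ^ (m' - k))"
    by (rule gbinomial_partial_sum_poly_xpos[symmetric])
  finally have "y ^ r * trunc_form r m x (x + y) =
      (\<Sum>k\<le>m'. (of_nat m' + of_nat r gchoose k) * x ^ k * (y ^ r * y ^ (m' - k)))"
    by (simp add: sum_distrib_left mult_ac)
  also have "\<dots> = (\<Sum>k\<le>m'. of_nat ((m' + r) choose k) * x ^ k * y ^ (m' + r - k))"
    by (intro sum.cong) (simp_all add: binomial_gbinomial add.commute flip: power_add)
  finally show ?thesis by (simp add: m' lessThan_Suc_atMost)
qed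

text \<open>
  The binomial expansion of \<open>(x + y)\<close> to the power \<open>m + n - 1\<close> splits into the monomials of degree less
  than \<open>m\<close> in \<open>x\<close>, which are divisible by \<open>y\<^sup>n\<close>, and the others, which are divisible by \<open>x\<^sup>m\<close>.
\<close>

lemma trunc_form_bezout:
  fixes x y :: complex
  assumes "m > 0" "n > 0"
  shows "x ^ m * trunc_form m n y (x + y) + y ^ n * trunc_form n m x (x + y) = (x + y) ^ (m + n - 1)"
proof -
  define N where "N = m + n - 1"
  have N: "m + n = Suc N" using assms by (simp add: N_def)
  let ?t = "\<lambda>k. of_nat (N choose k) * x ^ k * y ^ (N - k)"
  have sym: "N choose (N - k) = N choose k" if "k \<le> N" for k
    using binomial_symmetric[OF that] by simp
  have "x ^ m * trunc_form m n y (x + y) = (\<Sum>k<n. of_nat (N choose k) * y ^ k * x ^ (N - k))"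
    using trunc_form_eq_partial_binomial[of n m x y] assms by (simp add: add.commute N_def)
  also have "\<dots> = (\<Sum>k\<in>{m..N}. ?t k)"
    by (rule sum.reindex_bij_witness[where i = "\<lambda>k. N - k" and j = "\<lambda>k. N - k"])
      (use assms N in \<open>auto simp: sym\<close>)
  moreover have "y ^ n * trunc_form n m x (x + y) = (\<Sum>k<m. ?t k)"
    using trunc_form_eq_partial_binomial[of m n y x] assms by (simp add: N_def)
  moreover have "(x + y) ^ N = (\<Sum>k\<in>{..<m} \<union> {m..N}. ?t k)"
    unfolding binomial_ring using assms N by (intro sum.cong) auto
  moreover have "\<dots> = (\<Sum>k<m. ?t k) + (\<Sum>k\<in>{m..N}. ?t k)"
    by (rule sum.union_disjoint) auto
  ultimately show ?thesis by (simp add: N_def)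
qed

lemma trunc_form_homogeneous:
  "m > 0 \<Longrightarrow> trunc_form r m (x * w) (l * w) = w ^ (m - 1) * trunc_form r m x l"
  unfolding trunc_form_def sum_distrib_left
proof (intro sum.cong refl)
  fix k assume "k \<in> {..<m}"
  then have "w ^ (m - 1) = w ^ k * w ^ (m - 1 - k)" by (simp flip: power_add)
  then show "of_nat (r + k - 1 choose k) * (x * w) ^ k * (l * w) ^ (m - 1 - k) =
      w ^ (m - 1) * (of_nat (r + k - 1 choose k) * x ^ k * l ^ (m - 1 - k))"
    by (simp add: power_mult_distrib algebra_simps)
qed

lemma trunc_form_zero:
  assumes "m > 0"
  shows "trunc_form r m x 0 = of_nat ((r + m - 2) choose (m - 1)) * x ^ (m - 1)"
proof -
  have "trunc_form r m x 0 = (\<Sum>k<m. if k = m - 1 then of_nat ((r + k - 1) choose k) * x ^ k else 0)"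
    unfolding trunc_form_def by (intro sum.cong) (auto simp: power_0_left)
  then show ?thesis using assms by (simp add: numeral_2_eq_2)
qed

lemma polynomial_fun_trunc_form:
  "polynomial_fun f \<Longrightarrow> polynomial_fun l \<Longrightarrow> polynomial_fun (\<lambda>z. trunc_form r m (f z) (l z))"
  unfolding trunc_form_def by (intro polynomial_fun_intros)

lemma cong_along_trunc_form:
  "cong_along X l k f f' \<Longrightarrow> cong_along X l k g g' \<Longrightarrow>
    cong_along X l k (\<lambda>z. trunc_form r m (f z) (g z)) (\<lambda>z. trunc_form r m (f' z) (g' z))"
  unfolding trunc_form_def by (intro cong_along_intros cong_along_refl polynomial_fun.const)

section \<open>The branch equation and its Hensel root\<close>

text \<open>
  Multiplied by \<open>w\<^sup>m\<^sup>-\<^sup>1\<close>, the equation \<open>x\<^sup>m w = B\<close> becomes the vanishing of this polynomial at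
  \<open>h = x w\<close> and \<open>s = l w\<close>.
  The ring is left general so that \<open>h\<close> and \<open>s\<close> can be numbers as well as polynomials in one variable.
\<close>

definition branch_eqn :: "nat \<Rightarrow> nat \<Rightarrow> 'a::comm_ring_1 \<Rightarrow> 'a \<Rightarrow> 'a" where
  "branch_eqn r m h s = h ^ m - trunc_form r m h s"

text \<open>
  The divided difference of \<open>branch_eqn\<close> in its first argument, and hence its derivative on the diagonal.
\<close>

definition branch_quotient :: "nat \<Rightarrow> nat \<Rightarrow> 'a::comm_ring_1 \<Rightarrow> 'a \<Rightarrow> 'a \<Rightarrow> 'a" where
  "branch_quotient r m h h' s = (\<Sum>i<m. h' ^ (m - Suc i) * h ^ i) -
     (\<Sum>k<m. of_nat ((r + k - 1) choose k) * (\<Sum>i<k. h' ^ (k - Suc i) * h ^ i) * s ^ (m - 1 - k))"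

lemma branch_eqn_diff:
  "branch_eqn r m h s - branch_eqn r m h' s = branch_quotient r m h h' s * (h - h')"
proof -
  have "branch_eqn r m h s - branch_eqn r m h' s = (h ^ m - h' ^ m) -
      (\<Sum>k<m. of_nat ((r + k - 1) choose k) * (h ^ k - h' ^ k) * s ^ (m - 1 - k))"
    unfolding branch_eqn_def trunc_form_def by (simp add: algebra_simps sum_subtractf)
  also have "\<dots> = branch_quotient r m h h' s * (h - h')"
    unfolding power_diff_sumr2 branch_quotient_def
    by (simp add: algebra_simps sum_distrib_left sum_distrib_right)
  finally show ?thesis .
qed

text \<open>
  At \<open>s = 0\<close> the branch equation degenerates to \<open>h\<^sup>m\<^sup>-\<^sup>1 (h - \<beta>)\<close>, so \<open>\<beta>\<close> is a simple root.
\<close>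

lemma branch_quotient_at_root:
  fixes r m :: nat
  assumes "m > 0"
  defines "\<beta> \<equiv> of_nat ((r + m - 2) choose (m - 1))"
  shows "branch_quotient r m \<beta> \<beta> 0 = (\<beta> :: complex) ^ (m - 1)"
proof -
  have pow: "(\<Sum>i<k. \<beta> ^ (k - Suc i) * \<beta> ^ i) = of_nat k * \<beta> ^ (k - 1)" for k
  proof -
    have "(\<Sum>i<k. \<beta> ^ (k - Suc i) * \<beta> ^ i) = (\<Sum>i<k. \<beta> ^ (k - 1))"
      by (intro sum.cong) (simp_all flip: power_add)
    then show ?thesis by simp
  qed
  obtain m' where m': "m = Suc m'" using assms(1) by (cases m) auto
  have "(\<Sum>k<m. of_nat ((r + k - 1) choose k) * (of_nat k * \<beta> ^ (k - 1)) * 0 ^ (m - 1 - k)) =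
      \<beta> * (of_nat m' * \<beta> ^ (m' - 1))"
  proof -
    have "(\<Sum>k<m. of_nat ((r + k - 1) choose k) * (of_nat k * \<beta> ^ (k - 1)) * 0 ^ (m - 1 - k)) =
      (\<Sum>k<m. if k = m' then of_nat ((r + k - 1) choose k) * (of_nat k * \<beta> ^ (k - 1)) else 0)"
      by (intro sum.cong) (auto simp: m' power_0_left)
    then show ?thesis by (simp add: m' \<beta>_def numeral_2_eq_2)
  qed
  then have "branch_quotient r m \<beta> \<beta> 0 = of_nat m * \<beta> ^ m' - of_nat m' * (\<beta> * \<beta> ^ (m' - 1))"
    unfolding branch_quotient_def pow by (simp add: m')
  also have "of_nat m' * (\<beta> * \<beta> ^ (m' - 1)) = of_nat m' * \<beta> ^ m'"
    by (cases m') auto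
  finally show ?thesis by (simp add: m' algebra_simps)
qed

lemma poly_trunc_form: "poly (trunc_form r m P Q) s = trunc_form r m (poly P s) (poly Q s)"
  unfolding trunc_form_def by (simp add: poly_sum)

lemma poly_branch_eqn: "poly (branch_eqn r m P Q) s = branch_eqn r m (poly P s) (poly Q s)"
  unfolding branch_eqn_def by (simp add: poly_trunc_form)

lemma poly_branch_quotient:
  "poly (branch_quotient r m P P' Q) s = branch_quotient r m (poly P s) (poly P' s) (poly Q s)"
  unfolding branch_quotient_def by (simp add: poly_sum)

text \<open>
  Hensel's lemma for the simple root \<open>\<beta>\<close>: adding \<open>c s\<close> to the power \<open>N + 1\<close> to an approximate root
  changes the lowest coefficient of the error by \<open>c\<close> times the nonzero derivative.
\<close>

lemma branch_eqn_truncated_root: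
  fixes r m N :: nat
  assumes "m > 0" "r > 0"
  defines "\<beta> \<equiv> (of_nat ((r + m - 2) choose (m - 1)) :: complex)"
  shows "\<exists>H. poly H 0 = \<beta> \<and> [:0, 1:] ^ Suc N dvd branch_eqn r m H [:0, 1:]"
proof (induction N)
  case 0
  have "branch_eqn r m \<beta> 0 = 0"
    using assms(1) by (cases m) (simp_all add: branch_eqn_def trunc_form_zero \<beta>_def)
  then have "poly (branch_eqn r m [:\<beta>:] [:0, 1:]) 0 = 0"
    by (simp add: poly_branch_eqn)
  then show ?case
    by (intro exI[of _ "[:\<beta>:]"]) (simp add: poly_eq_0_iff_dvd)
next
  case (Suc N)
  let ?X = "[:0, 1:] :: complex poly"
  obtain H E where H: "poly H 0 = \<beta>" "branch_eqn r m H ?X = ?X ^ Suc N * E"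
    using Suc by (auto elim: dvdE)
  have "\<beta> \<noteq> 0"
    using assms by simp
  \<comment> \<open>The Newton correction that cancels the constant coefficient of the cofactor \<open>E\<close>.\<close>
  define c where "c = - poly E 0 / \<beta> ^ (m - 1)"
  define H' where "H' = H + ?X ^ Suc N * [:c:]"
  have H'0: "poly H' 0 = \<beta>" by (simp add: H'_def H)
  have "branch_eqn r m H' ?X = branch_eqn r m H ?X + branch_quotient r m H' H ?X * (H' - H)"
    by (simp flip: branch_eqn_diff)
  also have "\<dots> = ?X ^ Suc N * (E + branch_quotient r m H' H ?X * [:c:])"
    unfolding H(2) by (simp add: H'_def algebra_simps)
  finally have eq: "branch_eqn r m H' ?X = ?X ^ Suc N * (E + branch_quotient r m H' H ?X * [:c:])" .
  have "poly (E + branch_quotient r m H' H ?X * [:c:]) 0 = poly E 0 + \<beta> ^ (m - 1) * c"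
    using branch_quotient_at_root[OF assms(1), of r]
    by (simp add: poly_branch_quotient H'0 H(1) \<beta>_def)
  also have "\<dots> = 0" using \<open>\<beta> \<noteq> 0\<close> by (simp add: c_def)
  finally have "[:- 0, 1:] dvd E + branch_quotient r m H' H ?X * [:c:]"
    by (simp only: poly_eq_0_iff_dvd)
  then have "?X dvd E + branch_quotient r m H' H ?X * [:c:]"
    by (simp only: minus_zero)
  then have "?X ^ Suc (Suc N) dvd branch_eqn r m H' ?X"
    unfolding eq power_Suc2[of _ "Suc N"] by (rule mult_dvd_mono[OF dvd_refl])
  then show ?case using H'0 by blast
qed

lemma cong_along_branch_eqn:
  "cong_along X l k f f' \<Longrightarrow> cong_along X l k g g' \<Longrightarrow>
    cong_along X l k (\<lambda>z. branch_eqn r m (f z) (g z)) (\<lambda>z. branch_eqn r m (f' z) (g' z))"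
  unfolding branch_eqn_def by (intro cong_along_intros cong_along_trunc_form)

text \<open>
  The uniqueness half of Hensel's lemma: two roots that agree with \<open>\<beta>\<close> modulo \<open>l\<close> have a
  divided difference that is a unit modulo \<open>l\<close>, and it can be cancelled.
\<close>

lemma branch_eqn_root_unique:
  fixes r m k :: nat
  assumes "m > 0" "r > 0" and l: "polynomial_fun l"
  defines "\<beta> \<equiv> (of_nat ((r + m - 2) choose (m - 1)) :: complex)"
  assumes s: "cong_along X l 1 s (\<lambda>_. 0)"
    and h: "cong_along X l 1 h (\<lambda>_. \<beta>)" and h': "cong_along X l 1 h' (\<lambda>_. \<beta>)"
    and roots: "cong_along X l k (\<lambda>z. branch_eqn r m (h z) (s z)) (\<lambda>z. branch_eqn r m (h' z) (s z))"
  shows "cong_along X l k h h'"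
proof -
  let ?G = "\<lambda>z. branch_quotient r m (h z) (h' z) (s z)"
  have "cong_along X l 1 ?G (\<lambda>z. branch_quotient r m \<beta> \<beta> 0)"
    unfolding branch_quotient_def
    by (intro cong_along_intros cong_along_refl polynomial_fun.const s h h')
  then have G: "cong_along X l 1 (\<lambda>z. ?G z * 1) (\<lambda>_. \<beta> ^ (m - 1))"
    using branch_quotient_at_root[OF assms(1), of r] by (simp add: \<beta>_def)
  have p: "polynomial_fun h" "polynomial_fun h'" "polynomial_fun ?G"
    using h h' G by (auto simp: cong_along_def)
  from roots obtain q where q: "polynomial_fun q"
    "\<And>z. z \<in> X \<Longrightarrow> branch_eqn r m (h z) (s z) - branch_eqn r m (h' z) (s z) = l z ^ k * q z"
    by (auto elim: cong_alongE)
  have "cong_along X l k (\<lambda>z. ?G z * h z) (\<lambda>z. ?G z * h' z)"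
    by (rule cong_alongI[where q = q])
      (use p q in \<open>simp_all add: polynomial_fun_basic branch_eqn_diff right_diff_distrib\<close>)
  moreover have "\<beta> ^ (m - 1) \<noteq> 0"
    using assms(1,2) unfolding \<beta>_def by simp arith
  ultimately show ?thesis
    using cong_along_cancel_unit[OF G _ polynomial_fun.const p(1,2) _ l] by blast
qed

section \<open>The isomorphism between the hypersurfaces\<close>

definition point4 :: "complex \<Rightarrow> complex \<Rightarrow> complex \<Rightarrow> complex \<Rightarrow> complex^4" where
  "point4 a b c d = (\<chi> i. if i = 1 then a else if i = 2 then b else if i = 3 then c else d)"

lemma point4_nth [simp]:
  "point4 a b c d $ 1 = a" "point4 a b c d $ 2 = b" "point4 a b c d $ 3 = c" "point4 a b c d $ 4 = d"
  by (simp_all add: point4_def)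

lemma point4_eq_iff: "point4 a b c d = z \<longleftrightarrow> a = z $ 1 \<and> b = z $ 2 \<and> c = z $ 3 \<and> d = z $ 4"
  by (auto simp: vec_eq_iff forall_4)

lemma polynomial_fun_point4:
  assumes "polynomial_fun a" "polynomial_fun b" "polynomial_fun c" "polynomial_fun d"
  shows "polynomial_fun (\<lambda>z. point4 (a z) (b z) (c z) (d z) $ i)"
proof -
  have "\<forall>i. polynomial_fun (\<lambda>z. point4 (a z) (b z) (c z) (d z) $ i)"
    unfolding forall_4 using assms by simp
  then show ?thesis by blast
qed

lemma mem_X_hyp: "z \<in> X_hyp m n \<longleftrightarrow> z $ 1 ^ m * z $ 4 - z $ 2 ^ n * z $ 3 = 1"
  by (simp add: X_hyp_def zero_locus_def)

text \<open>
  The linear form \<open>x + c y\<close> vanishes nowhere densely.  At a point where it vanishes, \<open>y\<close> is nonzero,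
  so one can move \<open>x\<close> away and solve the equation for \<open>u\<close>.  Density in the Euclidean topology is enough,
  because polynomials are continuous.
\<close>

lemma X_hyp_generic_closure:
  assumes "m > 0" "n > 0" and z: "z \<in> X_hyp m n"
  shows "z \<in> closure {w \<in> X_hyp m n. w $ 1 + c * w $ 2 \<noteq> 0}"
proof (cases "z $ 1 + c * z $ 2 = 0")
  case False
  then show ?thesis using z by (intro subsetD[OF closure_subset]) simp
next
  case True
  have y: "z $ 2 \<noteq> 0"
  proof
    assume "z $ 2 = 0"
    with True z assms show False by (simp add: mem_X_hyp power_0_left)
  qed
  define \<gamma> where "\<gamma> t = point4 (z $ 1 + t) (z $ 2) (((z $ 1 + t) ^ m * z $ 4 - 1) / z $ 2 ^ n) (z $ 4)" for t
  have \<gamma>0: "\<gamma> 0 = z"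
    using z y by (simp add: \<gamma>_def point4_eq_iff mem_X_hyp field_simps)
  have \<gamma>t: "\<gamma> t \<in> {w \<in> X_hyp m n. w $ 1 + c * w $ 2 \<noteq> 0}" if "t \<noteq> 0" for t
  proof -
    have "z $ 1 + t + c * z $ 2 = t" using True by (simp add: algebra_simps)
    then have "z $ 1 + t + c * z $ 2 \<noteq> 0" using that by metis
    then show ?thesis using y by (simp add: \<gamma>_def mem_X_hyp)
  qed
  define t where "t k = complex_of_real (inverse (real (Suc k)))" for k
  have "t \<longlonglongrightarrow> 0"
    using tendsto_of_real[OF LIMSEQ_inverse_real_of_nat, where 'a = complex] unfolding t_def by simp
  moreover have "isCont (\<lambda>t. \<gamma> t $ i) 0" for i
    unfolding \<gamma>_def point4_def using y by (cases "i = 1"; cases "i = 2"; cases "i = 3") auto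
  ultimately have "(\<lambda>k. \<gamma> (t k) $ i) \<longlonglongrightarrow> z $ i" for i
    using isCont_tendsto_compose[of 0 "\<lambda>t. \<gamma> t $ i" t] by (simp add: \<gamma>0)
  then have "(\<lambda>k. \<gamma> (t k)) \<longlonglongrightarrow> z"
    by (rule vec_tendstoI)
  moreover have "\<gamma> (t k) \<in> {w \<in> X_hyp m n. w $ 1 + c * w $ 2 \<noteq> 0}" for k
    by (rule \<gamma>t) (simp add: t_def del: of_nat_Suc)
  ultimately show ?thesis
    unfolding closure_sequential by (intro exI[of _ "\<lambda>k. \<gamma> (t k)"]) blast
qed

text \<open>
  The form \<open>x + c y\<close> is not a zero divisor on the hypersurface.  The coordinates defined
  by a division are known only through their products with a power of such a form, and identities
  between them are deduced by cancelling it.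
\<close>

lemma X_hyp_cancel:
  assumes "m > 0" "n > 0" and z: "z \<in> X_hyp m n" and f: "polynomial_fun f" and g: "polynomial_fun g"
    and eq: "\<And>w. w \<in> X_hyp m n \<Longrightarrow> (w $ 1 + c * w $ 2) ^ k * f w = (w $ 1 + c * w $ 2) ^ k * g w"
  shows "f z = g z"
proof -
  have "f z - g z = 0"
    by (rule continuous_constant_on_closure[OF
          continuous_on_polynomial_fun[OF polynomial_fun_diff[OF f g]] _
          X_hyp_generic_closure[OF assms(1,2) z]])
      (use eq in auto)
  then show ?thesis by simp
qed

text \<open>
  The two exponents enter the cocycle of the projection \<open>(l, w)\<close> only through \<open>m + n - 1\<close>.  Both
  directions rest on the same two facts: the product \<open>x w\<close> is congruent to \<open>H(l w)\<close> modulo \<open>l\<^sup>N\<close>, and it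
  is congruent to the nonzero constant \<open>\<beta>\<close> modulo \<open>l\<close>, so that \<open>x\<close> and \<open>w\<close> are units there.  On \<open>X\<^sub>m\<^sub>,\<^sub>n\<close>
  the first is derived from the equation of \<open>u\<close>; on \<open>X\<^sub>N\<^sub>,\<^sub>1\<close> it is the defining equation and yields \<open>u\<close>.
\<close>

lemma X_hyp_isomorphic_X_hyp_1:
  assumes "m > 0" "n > 0"
  shows "isomorphic_varieties (X_hyp m n) (X_hyp (m + n - 1) 1)"
proof -
  define N where "N = m + n - 1"
  have N: "N > 0" using assms by (simp add: N_def)
  define \<beta> :: complex where "\<beta> = of_nat ((n + m - 2) choose (m - 1))"
  have \<beta>: "\<beta> \<noteq> 0" using assms by (simp add: \<beta>_def)
  \<comment> \<open>The forms \<open>A\<close> and \<open>B\<close> have the same leading coefficient at \<open>l = 0\<close>.\<close>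
  have \<beta>': "\<beta> = of_nat ((m + n - 2) choose (n - 1))"
    using assms binomial_symmetric[of "m - 1" "n + m - 2"] by (simp add: \<beta>_def add.commute numeral_2_eq_2)
  obtain H where H: "poly H 0 = \<beta>" "[:0, 1:] ^ N dvd branch_eqn n m H [:0, 1:]"
    using branch_eqn_truncated_root[OF assms, of "N - 1"] N by (auto simp: \<beta>_def)
  obtain E where E: "branch_eqn n m H [:0, 1:] = [:0, 1:] ^ N * E"
    using H(2) by (auto elim: dvdE)
  obtain K where K: "H = pCons \<beta> K"
    using H(1) by (cases H) auto
  have Hs: "poly H s = \<beta> + s * poly K s" for s
    by (simp add: K)
  have root: "branch_eqn n m (poly H s) s = s ^ N * poly E s" for s
    using arg_cong[OF E, of "\<lambda>P. poly P s"] by (simp add: poly_branch_eqn)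
  have homog: "branch_eqn n m (x * w) (l * w) = w ^ (m - 1) * (x ^ m * w) - w ^ (m - 1) * trunc_form n m x l"
    for x w l :: complex
    using assms by (cases m) (simp_all add: branch_eqn_def trunc_form_homogeneous power_mult_distrib)

  let ?X = "X_hyp m n" and ?Z = "X_hyp N 1"
  let ?A = "\<lambda>x y :: complex. trunc_form m n y (x + y)" and ?B = "\<lambda>x y :: complex. trunc_form n m x (x + y)"
  have bezout: "x ^ m * ?A x y + y ^ n * ?B x y = (x + y) ^ N" for x y
    using trunc_form_bezout[OF assms] by (simp add: N_def)

  define l where "l = (\<lambda>z :: complex^4. z $ 1 + z $ 2)"
  define w where "w = (\<lambda>z :: complex^4. ?A (z $ 1) (z $ 2) * z $ 3 + ?B (z $ 1) (z $ 2) * z $ 4)"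
  have l_poly: "polynomial_fun l" unfolding l_def by (intro polynomial_fun_intros)
  have w_poly: "polynomial_fun w"
    unfolding w_def by (intro polynomial_fun_intros polynomial_fun_trunc_form)
  have solve: "X * (A * u + B * v) - B = (X * A + Y * B) * u"
      "Y * (A * u + B * v) + A = (X * A + Y * B) * v"
    if "X * v - Y * u = 1" for X Y A B u v :: complex
    using that by algebra+
  have quotients: "X * (Y * w + A) - X * 0 = L * (Y * a + 1)"
    if "X * w - B = L * a" "X * A + Y * B = L" for X Y A B L w a :: complex
    using that by algebra
  have recover: "L * (X * b - Y * a) = L * 1" "L * (A * a + B * b) = L * w"
    if "X * w - B = L * a" "Y * w + A = L * b" "X * A + Y * B = L" for X Y A B L w a b :: complex
    using that by algebra+
  have u_eq: "z $ 1 ^ m * w z - ?B (z $ 1) (z $ 2) = l z ^ N * z $ 3"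
    and v_eq: "z $ 2 ^ n * w z + ?A (z $ 1) (z $ 2) = l z ^ N * z $ 4" if "z \<in> ?X" for z
    using solve[OF that[unfolded mem_X_hyp]] unfolding w_def l_def bezout[symmetric] by blast+

  have s_X: "cong_along ?X l 1 (\<lambda>z. l z * w z) (\<lambda>_. 0)"
    by (rule cong_alongI[where q = w]) (simp_all add: l_poly w_poly polynomial_fun_intros)
  have l_X: "cong_along ?X l 1 l (\<lambda>_. 0)"
    by (rule cong_alongI[where q = "\<lambda>_. 1"]) (simp_all add: l_poly polynomial_fun_intros)
  \<comment> \<open>Modulo \<open>l\<close>, where \<open>x = - y\<close>, the function \<open>x w\<close> reduces to \<open>\<beta>\<close> times the defining equation.\<close>
  have xw_X: "cong_along ?X l 1 (\<lambda>z. z $ 1 * w z) (\<lambda>_. \<beta>)"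
  proof -
    have x: "cong_along ?X l 1 (\<lambda>z. z $ 1) (\<lambda>z. - z $ 2)"
      by (rule cong_alongI[where q = "\<lambda>_. 1"]) (simp_all add: l_def polynomial_fun_intros)
    have A: "cong_along ?X l 1 (\<lambda>z. ?A (z $ 1) (z $ 2)) (\<lambda>z. \<beta> * z $ 2 ^ (n - 1))"
      using cong_along_trunc_form[OF cong_along_refl[OF polynomial_fun.coord] l_X, of m n 2] assms
      by (simp add: l_def trunc_form_zero \<beta>')
    have B: "cong_along ?X l 1 (\<lambda>z. ?B (z $ 1) (z $ 2)) (\<lambda>z. \<beta> * z $ 1 ^ (m - 1))"
      using cong_along_trunc_form[OF cong_along_refl[OF polynomial_fun.coord] l_X, of n m 1] assms
      by (simp add: l_def trunc_form_zero \<beta>_def)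
    have "cong_along ?X l 1
       (\<lambda>z. z $ 1 * (?A (z $ 1) (z $ 2) * z $ 3) + z $ 1 * (?B (z $ 1) (z $ 2) * z $ 4))
       (\<lambda>z. (- z $ 2) * ((\<beta> * z $ 2 ^ (n - 1)) * z $ 3) + z $ 1 * ((\<beta> * z $ 1 ^ (m - 1)) * z $ 4))"
      by (intro cong_along_intros x A B cong_along_refl polynomial_fun_intros)
    moreover have "cong_along ?X l 1
       (\<lambda>z. (- z $ 2) * ((\<beta> * z $ 2 ^ (n - 1)) * z $ 3) + z $ 1 * ((\<beta> * z $ 1 ^ (m - 1)) * z $ 4)) (\<lambda>_. \<beta>)"
    proof (rule cong_alongI[where q = "\<lambda>_. 0"])
      fix z assume z: "z \<in> ?X"
      have "(- z $ 2) * ((\<beta> * z $ 2 ^ (n - 1)) * z $ 3) + z $ 1 * ((\<beta> * z $ 1 ^ (m - 1)) * z $ 4) =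
          \<beta> * (z $ 1 ^ m * z $ 4 - z $ 2 ^ n * z $ 3)"
        using assms by (cases m; cases n) (simp_all add: algebra_simps)
      with z show "(- z $ 2) * ((\<beta> * z $ 2 ^ (n - 1)) * z $ 3) + z $ 1 * ((\<beta> * z $ 1 ^ (m - 1)) * z $ 4) - \<beta>
          = l z ^ 1 * 0" by (simp add: mem_X_hyp)
    qed (intro polynomial_fun_intros)+
    ultimately show ?thesis
      using cong_along_trans by (fastforce simp: w_def distrib_left)
  qed
  have H_cong: "cong_along Y l' 1 (\<lambda>z. poly H (s z)) (\<lambda>_. \<beta>)"
    if s: "cong_along Y l' 1 s (\<lambda>_. 0)" for Y :: "(complex^4) set" and l' s
  proof -
    have "polynomial_fun s" using s by (simp add: cong_along_def)
    then have "cong_along Y l' 1 (\<lambda>z. \<beta> + s z * poly K (s z)) (\<lambda>z. \<beta> + 0 * poly K (s z))"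
      by (intro cong_along_intros s cong_along_refl polynomial_fun_intros)
    then show ?thesis by (simp add: Hs)
  qed
  have root_cong: "cong_along Y l' N (\<lambda>z. branch_eqn n m (poly H (l' z * w' z)) (l' z * w' z)) (\<lambda>_. 0)"
    if "polynomial_fun l'" "polynomial_fun w'" for Y :: "(complex^4) set" and l' w'
    by (rule cong_alongI[where q = "\<lambda>z. w' z ^ N * poly E (l' z * w' z)"])
      (use that in \<open>simp_all add: root polynomial_fun_intros power_mult_distrib\<close>)

  have "cong_along ?X l N (\<lambda>z. branch_eqn n m (z $ 1 * w z) (l z * w z)) (\<lambda>_. 0)"
  proof (rule cong_alongI[where q = "\<lambda>z. w z ^ (m - 1) * z $ 3"])
    show "branch_eqn n m (z $ 1 * w z) (l z * w z) - 0 = l z ^ N * (w z ^ (m - 1) * z $ 3)"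
      if "z \<in> ?X" for z
      using u_eq[OF that] unfolding homog by (simp add: l_def flip: right_diff_distrib)
  qed (auto simp: branch_eqn_def intro!: polynomial_fun_intros polynomial_fun_trunc_form l_poly w_poly)
  then have "cong_along ?X l N (\<lambda>z. z $ 1 * w z) (\<lambda>z. poly H (l z * w z))"
    using branch_eqn_root_unique[OF assms l_poly, folded \<beta>_def, OF s_X xw_X H_cong[OF s_X]]
      cong_along_trans cong_along_sym[OF root_cong[OF l_poly w_poly]] by blast
  then obtain g where g: "polynomial_fun g"
    "\<And>z. z \<in> ?X \<Longrightarrow> z $ 1 * w z - poly H (l z * w z) = l z ^ N * g z"
    by (auto elim: cong_alongE)
  define \<phi> where "\<phi> z = point4 (l z) (w z) (- (z $ 1 - l z * poly K (l z * w z)) / \<beta>) (- g z / \<beta>)" for z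
  have \<phi>_poly: "polynomial_fun (\<lambda>z. \<phi> z $ i)" for i
    unfolding \<phi>_def
    by (intro polynomial_fun_point4 polynomial_fun_intros l_poly w_poly g(1))
  have \<phi>_maps: "\<phi> z \<in> ?Z" if "z \<in> ?X" for z
    using g(2)[OF that] \<beta> by (simp add: mem_X_hyp \<phi>_def Hs field_simps)

  \<comment> \<open>The inverse: \<open>x\<close> is found by solving the third coordinate of \<open>\<phi>\<close> for it.\<close>
  define x where "x = (\<lambda>z :: complex^4. z $ 1 * poly K (z $ 1 * z $ 2) - \<beta> * z $ 3)"
  define y where "y = (\<lambda>z :: complex^4. z $ 1 - x z)"
  have x_poly: "polynomial_fun x" unfolding x_def by (intro polynomial_fun_intros)
  have y_poly: "polynomial_fun y" unfolding y_def by (intro polynomial_fun_intros x_poly)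
  let ?l = "\<lambda>z :: complex^4. z $ 1" and ?w = "\<lambda>z :: complex^4. z $ 2"
  have lw_poly: "polynomial_fun ?l" "polynomial_fun ?w" by (intro polynomial_fun_intros)+
  have xy: "x z + y z = z $ 1" for z by (simp add: y_def)
  have s_Z: "cong_along ?Z ?l 1 (\<lambda>z. z $ 1 * z $ 2) (\<lambda>_. 0)"
    by (rule cong_alongI[where q = ?w]) (simp_all add: polynomial_fun_intros)
  have xw_Z: "cong_along ?Z ?l N (\<lambda>z. x z * z $ 2) (\<lambda>z. poly H (z $ 1 * z $ 2))"
  proof (rule cong_alongI[where q = "\<lambda>z. - \<beta> * z $ 4"])
    fix z assume "z \<in> ?Z"
    then have "z $ 2 * z $ 3 + 1 = z $ 1 ^ N * z $ 4"
      by (simp add: mem_X_hyp algebra_simps)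
    moreover have "x z * z $ 2 - poly H (z $ 1 * z $ 2) = - \<beta> * (z $ 2 * z $ 3 + 1)"
      by (simp add: x_def Hs algebra_simps)
    ultimately show "x z * z $ 2 - poly H (z $ 1 * z $ 2) = z $ 1 ^ N * (- \<beta> * z $ 4)"
      by (simp only: mult_ac)
  qed (intro polynomial_fun_intros x_poly)+
  have x_unit: "cong_along ?Z ?l 1 (\<lambda>z. x z * z $ 2) (\<lambda>_. \<beta>)"
    using cong_along_trans[OF cong_along_mono[OF xw_Z _ lw_poly(1)] H_cong[OF s_Z]] N by simp
  have u_Z: "cong_along ?Z ?l N (\<lambda>z. x z ^ m * z $ 2) (\<lambda>z. ?B (x z) (y z))"
  proof -
    have "cong_along ?Z ?l N (\<lambda>z. branch_eqn n m (x z * z $ 2) (z $ 1 * z $ 2)) (\<lambda>_. 0)"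
      by (rule cong_along_trans[OF cong_along_branch_eqn[OF xw_Z cong_along_refl] root_cong[OF lw_poly]])
        (intro polynomial_fun_intros)
    then obtain q where q: "polynomial_fun q"
      "\<And>z. z \<in> ?Z \<Longrightarrow> branch_eqn n m (x z * z $ 2) (z $ 1 * z $ 2) = z $ 1 ^ N * q z"
      by (auto elim: cong_alongE)
    have cong: "cong_along ?Z ?l N (\<lambda>z. z $ 2 ^ (m - 1) * (x z ^ m * z $ 2)) (\<lambda>z. z $ 2 ^ (m - 1) * ?B (x z) (y z))"
      by (rule cong_alongI[where q = q])
        (use q in \<open>auto simp: homog xy intro!: polynomial_fun_intros polynomial_fun_trunc_form x_poly y_poly\<close>)
    have unit: "cong_along ?Z ?l 1 (\<lambda>z. z $ 2 ^ (m - 1) * x z ^ (m - 1)) (\<lambda>_. \<beta> ^ (m - 1))"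
      using cong_along_power[OF x_unit, of "m - 1"] by (simp add: power_mult_distrib mult.commute)
    show ?thesis
      by (rule cong_along_cancel_unit[OF unit _ _ _ _ cong lw_poly(1)])
        (use \<beta> in \<open>auto intro!: polynomial_fun_intros polynomial_fun_trunc_form x_poly y_poly\<close>)
  qed
  then obtain a where a: "polynomial_fun a"
    "\<And>z. z \<in> ?Z \<Longrightarrow> x z ^ m * z $ 2 - ?B (x z) (y z) = z $ 1 ^ N * a z"
    by (auto elim: cong_alongE)
  \<comment> \<open>Times \<open>x\<^sup>m\<close>, the numerator of \<open>v\<close> is \<open>y\<^sup>n\<close> times that of \<open>u\<close> plus \<open>l\<^sup>N\<close>, and \<open>x\<close> is a unit modulo \<open>l\<close>.\<close>
  have "cong_along ?Z ?l N (\<lambda>z. y z ^ n * z $ 2 + ?A (x z) (y z)) (\<lambda>_. 0)"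
  proof (rule cong_along_cancel_unit[where e = "\<lambda>z. x z ^ m" and r = "\<lambda>z. z $ 2 ^ m" and c = "\<beta> ^ m"])
    show "cong_along ?Z ?l 1 (\<lambda>z. x z ^ m * z $ 2 ^ m) (\<lambda>_. \<beta> ^ m)"
      using cong_along_power[OF x_unit, of m] by (simp add: power_mult_distrib)
    show "cong_along ?Z ?l N (\<lambda>z. x z ^ m * (y z ^ n * z $ 2 + ?A (x z) (y z))) (\<lambda>z. x z ^ m * 0)"
    proof (rule cong_alongI[where q = "\<lambda>z. y z ^ n * a z + 1"])
      fix z assume z: "z \<in> ?Z"
      show "x z ^ m * (y z ^ n * z $ 2 + ?A (x z) (y z)) - x z ^ m * 0 = z $ 1 ^ N * (y z ^ n * a z + 1)"
        using quotients[OF a(2)[OF z]] bezout[of "x z" "y z"] unfolding xy by blast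
    qed (intro polynomial_fun_intros polynomial_fun_trunc_form x_poly y_poly a(1))+
  qed (use \<beta> in \<open>auto intro!: polynomial_fun_intros polynomial_fun_trunc_form x_poly y_poly\<close>)
  then obtain b where b: "polynomial_fun b"
    "\<And>z. z \<in> ?Z \<Longrightarrow> y z ^ n * z $ 2 + ?A (x z) (y z) = z $ 1 ^ N * b z"
    by (auto elim: cong_alongE)
  define \<psi> where "\<psi> z = point4 (x z) (y z) (a z) (b z)" for z
  have \<psi>_poly: "polynomial_fun (\<lambda>z. \<psi> z $ i)" for i
    unfolding \<psi>_def by (intro polynomial_fun_point4 x_poly y_poly a(1) b(1))

  have cancel_X: "f z = g z"
    if "z \<in> ?X" "polynomial_fun f" "polynomial_fun g"
      "\<And>z. z \<in> ?X \<Longrightarrow> l z ^ N * f z = l z ^ N * g z" for f g z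
    by (rule X_hyp_cancel[OF assms that(1-3), of 1 N]) (use that(4) in \<open>simp add: l_def\<close>)
  have cancel_Z: "f z = g z"
    if "z \<in> ?Z" "polynomial_fun f" "polynomial_fun g"
      "\<And>z. z \<in> ?Z \<Longrightarrow> z $ 1 ^ N * f z = z $ 1 ^ N * g z" for f g z
    by (rule X_hyp_cancel[OF N zero_less_one that(1-3), of 0 N]) (use that(4) in simp)

  have \<psi>_maps: "\<psi> z \<in> ?X" if z: "z \<in> ?Z" for z
  proof -
    have "x z ^ m * b z - y z ^ n * a z = 1"
    proof (rule cancel_Z[where f = "\<lambda>z. x z ^ m * b z - y z ^ n * a z" and g = "\<lambda>z. 1", OF z])
      fix z assume z: "z \<in> ?Z"
      show "z $ 1 ^ N * (x z ^ m * b z - y z ^ n * a z) = z $ 1 ^ N * 1"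
        using recover(1)[OF a(2)[OF z] b(2)[OF z]] bezout[of "x z" "y z"] unfolding xy by blast
    qed (auto intro!: polynomial_fun_intros x_poly y_poly a(1) b(1))
    then show ?thesis by (simp add: mem_X_hyp \<psi>_def)
  qed

  have lw_\<phi>: "\<phi> z $ 1 = l z" "\<phi> z $ 2 = w z" for z
    by (simp_all add: \<phi>_def)
  have x_\<phi>: "x (\<phi> z) = z $ 1" and y_\<phi>: "y (\<phi> z) = z $ 2" for z
    using \<beta> by (simp_all add: x_def y_def \<phi>_def l_def)
  have \<psi>\<phi>: "\<psi> (\<phi> z) = z" if z: "z \<in> ?X" for z
  proof -
    have "a (\<phi> z) = z $ 3"
    proof (rule cancel_X[where f = "\<lambda>z. a (\<phi> z)" and g = "\<lambda>z. z $ 3", OF z])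
      fix z assume z: "z \<in> ?X"
      show "l z ^ N * a (\<phi> z) = l z ^ N * z $ 3"
        using a(2)[OF \<phi>_maps[OF z]] u_eq[OF z] unfolding x_\<phi> y_\<phi> lw_\<phi> by metis
    qed (auto intro!: polynomial_fun_compose[OF a(1)] \<phi>_poly polynomial_fun_intros)
    moreover have "b (\<phi> z) = z $ 4"
    proof (rule cancel_X[where f = "\<lambda>z. b (\<phi> z)" and g = "\<lambda>z. z $ 4", OF z])
      fix z assume z: "z \<in> ?X"
      show "l z ^ N * b (\<phi> z) = l z ^ N * z $ 4"
        using b(2)[OF \<phi>_maps[OF z]] v_eq[OF z] unfolding x_\<phi> y_\<phi> lw_\<phi> by metis
    qed (auto intro!: polynomial_fun_compose[OF b(1)] \<phi>_poly polynomial_fun_intros)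
    ultimately show ?thesis by (simp add: \<psi>_def point4_eq_iff x_\<phi> y_\<phi>)
  qed

  have l_\<psi>: "l (\<psi> z) = z $ 1" for z by (simp add: l_def \<psi>_def xy)
  have w_\<psi>: "w (\<psi> z) = z $ 2" if z: "z \<in> ?Z" for z
  proof (rule cancel_Z[where f = "\<lambda>z. w (\<psi> z)" and g = "\<lambda>z. z $ 2", OF z])
    fix z assume z: "z \<in> ?Z"
    have "w (\<psi> z) = ?A (x z) (y z) * a z + ?B (x z) (y z) * b z"
      by (simp add: w_def \<psi>_def)
    then show "z $ 1 ^ N * w (\<psi> z) = z $ 1 ^ N * z $ 2"
      using recover(2)[OF a(2)[OF z] b(2)[OF z]] bezout[of "x z" "y z"] unfolding xy by simp
  qed (auto intro!: polynomial_fun_compose[OF w_poly] \<psi>_poly polynomial_fun_intros)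
  have u_\<phi>\<psi>: "\<phi> (\<psi> z) $ 3 = z $ 3" if z: "z \<in> ?Z" for z
    using \<beta> w_\<psi>[OF z] by (simp add: \<phi>_def l_\<psi>) (simp add: \<psi>_def x_def)
  have \<phi>\<psi>: "\<phi> (\<psi> z) = z" if z: "z \<in> ?Z" for z
  proof -
    have "\<phi> (\<psi> z) $ 4 = z $ 4"
    proof (rule cancel_Z[where f = "\<lambda>z. \<phi> (\<psi> z) $ 4" and g = "\<lambda>z. z $ 4", OF z])
      fix z assume z: "z \<in> ?Z"
      have "\<phi> (\<psi> z) $ 1 = z $ 1" "\<phi> (\<psi> z) $ 2 = z $ 2"
        using w_\<psi>[OF z] l_\<psi> by (simp_all add: \<phi>_def)
      then show "z $ 1 ^ N * \<phi> (\<psi> z) $ 4 = z $ 1 ^ N * z $ 4"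
        using \<phi>_maps[OF \<psi>_maps[OF z]] u_\<phi>\<psi>[OF z] z by (simp add: mem_X_hyp algebra_simps)
    qed (auto intro!: polynomial_fun_compose[OF \<phi>_poly] \<psi>_poly polynomial_fun_intros)
    moreover have "\<phi> (\<psi> z) $ 1 = z $ 1" "\<phi> (\<psi> z) $ 2 = z $ 2"
      using w_\<psi>[OF z] l_\<psi> by (simp_all add: \<phi>_def)
    ultimately show ?thesis using u_\<phi>\<psi>[OF z] by (simp add: vec_eq_iff forall_4)
  qed
  have "isomorphic_varieties ?X ?Z"
    unfolding isomorphic_varieties_def
    using variety_morphism_polynomial_map[OF \<phi>_poly \<phi>_maps]
      variety_morphism_polynomial_map[OF \<psi>_poly \<psi>_maps] \<psi>\<phi> \<phi>\<psi> by blast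
  then show ?thesis by (simp add: N_def)
qed

theorem theorem1:
  fixes m n p q :: nat
  assumes "m > 0" "n > 0" "p > 0" "q > 0"
    and "m + n = p + q"
  shows "isomorphic_varieties (X_hyp m n) (X_hyp p q)"
  using X_hyp_isomorphic_X_hyp_1[OF assms(1,2)]
    isomorphic_varieties_sym[OF X_hyp_isomorphic_X_hyp_1[OF assms(3,4)]]
  unfolding assms(5) by (rule isomorphic_varieties_trans)

end
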